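(* Let $q$ be a prime power and let $1\le i<h$ with $(h-i)\mid h$. Let $L$ denote the relative trace from $\mathbb{F}_{q^h}$ to $\mathbb{F}_{q^{h-i}}$ and let $n$ be an integer with $\gcd(h-i,n)=1$. Then the point set $\mathcal{C}=\{\langle(L(x)^{q^n},x)\rangle_{\mathbb{F}_{q^h}}: x\in\mathbb{F}_{q^h}^*\}$ is an $\mathbb{F}_q$-linear $i$-club of rank $h$ in $\mathrm{PG}(1,q^h)$.
   Context: An $\mathbb{F}_q$-linear set of rank $k$ in $\mathrm{PG}(1,q^h)$ is the set of points $\{\langle w\rangle_{\mathbb{F}_{q^h}}: w\in W\setminus\{0\}\}$ for some $k$-dimensional $\mathbb{F}_q$-subspace $W$ of $\mathbb{F}_{q^h}^2$. The weight of a point $\langle v\rangle_{\mathbb{F}_{q^h}}$ in it is $\dim_{\mathbb{F}_q}(W\cap\langle v\rangle_{\mathbb{F}_{q^h}})$. An $i$-club of rank $k$ is an $\mathbb{F}_q$-linear set of rank $k$ in which one point (the head) has weight $i$ and all other points have weight $1$. The relative trace is $L(x)=\sum_{j=0}^{h/(h-i)-1}x^{q^{(h-i)j}}$. *)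

theory Defs
  imports "HOL-Library.Cardinality" "HOL-Library.Product_Plus" "HOL-Number_Theory.Prime_Powers"
begin

text \<open>
  An extension of fields is given by an embedding \<open>\<iota>\<close> of a field \<open>'k\<close> into a field \<open>'a\<close>.
  If \<open>'k\<close> has \<open>q\<close> elements and \<open>'a\<close> has \<open>q ^ h\<close> elements, the image of \<open>\<iota>\<close> is
  the unique subfield of \<open>'a\<close> of order \<open>q\<close>, so all results are independent of the choice of \<open>\<iota>\<close>.
\<close>

definition field_embedding :: "('k::field \<Rightarrow> 'a::field) \<Rightarrow> bool" where
  "field_embedding \<iota> \<longleftrightarrow>
     \<iota> 1 = 1 \<and> (\<forall>x y. \<iota> (x + y) = \<iota> x + \<iota> y) \<and> (\<forall>x y. \<iota> (x * y) = \<iota> x * \<iota> y)"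

definition scale2 :: "('k::field \<Rightarrow> 'a::field) \<Rightarrow> 'k \<Rightarrow> 'a \<times> 'a \<Rightarrow> 'a \<times> 'a" where
  "scale2 \<iota> c v = (\<iota> c * fst v, \<iota> c * snd v)"

lemma vector_space_scale2:
  assumes "field_embedding \<iota>"
  shows "vector_space (scale2 \<iota>)"
  using assms by unfold_locales (auto simp: field_embedding_def scale2_def algebra_simps)

lemma field_embedding_id: "field_embedding id"
  by (simp add: field_embedding_def)

text \<open>
  A point of the projective line over \<open>'a\<close> is identified with the one-dimensional
  \<open>'a\<close>-subspace of \<open>'a \<times> 'a\<close>, viewed as a set of vectors; \<open>scale2 id\<close> is the scalar
  multiplication by \<open>'a\<close> itself.
\<close>

definition proj_point :: "'a::field \<times> 'a \<Rightarrow> ('a \<times> 'a) set" where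
  "proj_point v = module.span (scale2 id) {v}"

definition points_of :: "('a::field \<times> 'a) set \<Rightarrow> ('a \<times> 'a) set set" where
  "points_of W = {proj_point w | w. w \<in> W - {0}}"

definition linear_set_of_rank ::
    "('k::field \<Rightarrow> 'a::field) \<Rightarrow> nat \<Rightarrow> ('a \<times> 'a) set \<Rightarrow> ('a \<times> 'a) set set \<Rightarrow> bool" where
  "linear_set_of_rank \<iota> k W C \<longleftrightarrow>
     module.subspace (scale2 \<iota>) W \<and> vector_space.dim (scale2 \<iota>) W = k \<and> C = points_of W"

definition weight ::
    "('k::field \<Rightarrow> 'a::field) \<Rightarrow> ('a \<times> 'a) set \<Rightarrow> ('a \<times> 'a) set \<Rightarrow> nat" where
  "weight \<iota> W P = vector_space.dim (scale2 \<iota>) (W \<inter> P)"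

text \<open>
  The weight of a point is relative to a subspace \<open>W\<close> defining the linear set,
  so rank and weights have to be witnessed by the same \<open>W\<close>.
\<close>

definition is_club ::
    "('k::field \<Rightarrow> 'a::field) \<Rightarrow> nat \<Rightarrow> nat \<Rightarrow> ('a \<times> 'a) set set \<Rightarrow> bool" where
  "is_club \<iota> i k C \<longleftrightarrow>
     (\<exists>W. linear_set_of_rank \<iota> k W C \<and>
        (\<exists>P\<in>C. weight \<iota> W P = i \<and> (\<forall>Q\<in>C - {P}. weight \<iota> W Q = 1)))"

text \<open>The trace from the field of order \<open>q ^ h\<close> to its subfield of order \<open>q ^ m\<close>, where \<open>m dvd h\<close>.\<close>

definition rel_trace :: "nat \<Rightarrow> nat \<Rightarrow> nat \<Rightarrow> 'a::field \<Rightarrow> 'a" where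
  "rel_trace q h m x = (\<Sum>j = 0..h div m - 1. x ^ (q ^ (m * j)))"

text \<open>
  The map \<open>x \<mapsto> x\<^bsup>q\<^sup>n\<^esup>\<close> for an integer \<open>n\<close>: on a finite field whose characteristic is the prime
  dividing \<open>q\<close>, raising to the power \<open>q\<close> is an automorphism, and a negative \<open>n\<close> refers to
  the powers of its inverse.
\<close>

definition frob_power :: "nat \<Rightarrow> int \<Rightarrow> 'a::field \<Rightarrow> 'a" where
  "frob_power q n x =
     (if n \<ge> 0 then x ^ (q ^ nat n) else inv (\<lambda>y. y ^ (q ^ nat (- n))) x)"

end

theory Submission
  imports Defs "HOL-Computational_Algebra.Polynomial"
begin

text \<open>
  Let \<open>\<phi>\<close> be the \<open>n\<close>-th power of the Frobenius map and \<open>W = {(\<phi> (L x), x)}\<close>. The vectors of \<open>W\<close>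
  on the point through \<open>(\<phi> (L x), x)\<close> correspond to the scalars \<open>c\<close> with
  \<open>\<phi> (L (c x)) = c \<phi> (L x)\<close>. If \<open>L x = 0\<close>, these form the set \<open>x\<^sup>-\<^sup>1 ker L\<close>, which has \<open>q ^ i\<close>
  elements: \<open>ker L\<close> and the image of \<open>L\<close> have at most \<open>q ^ i\<close> and \<open>q ^ (h - i)\<close> elements, being
  contained in the root sets of polynomials of these degrees, and the product of their sizes is
  \<open>q ^ h\<close>. If \<open>L x \<noteq> 0\<close>, then \<open>c = \<phi> (L (c x) / L x)\<close> lies in the field of order \<open>q ^ (h - i)\<close>;
  linearity of \<open>L\<close> over that field gives \<open>\<phi> c = c\<close>, so \<open>c\<close> is fixed both by the \<open>n\<close>-th and by the
  \<open>(h - i)\<close>-th power of the Frobenius map, hence by the Frobenius map itself.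
\<close>

section \<open>Counting\<close>

text \<open>Adjoining an independent vector \<open>b\<close> splits each element of the new span
  uniquely as \<open>scale k b + y\<close> with \<open>y\<close> in the old span, so the size is
  multiplied by \<open>CARD('k)\<close>.\<close>

lemma card_subspace_eq_power_dim:
  fixes scale :: "'k::{field, finite} \<Rightarrow> 'v::ab_group_add \<Rightarrow> 'v"
  assumes "vector_space scale" "module.subspace scale V" "finite V"
  shows "card V = CARD('k) ^ vector_space.dim scale V"
proof -
  interpret vector_space scale by fact
  have card_span: "card (span B) = CARD('k) ^ card B" if "finite B" "independent B" for B
    using that
  proof (induction B rule: finite_induct)
    case (insert b B)
    have b: "b \<notin> span B" and B: "independent B"
      using insert.prems insert.hyps by (auto simp: independent_insert split: if_splits)
    let ?f = "\<lambda>(k, y). scale k b + y"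
    have "inj_on ?f (UNIV \<times> span B)"
    proof (rule inj_onI, clarsimp)
      fix k l y z
      assume yz: "y \<in> span B" "z \<in> span B" and eq: "scale k b + y = scale l b + z"
      have "scale (k - l) b = z - y"
        using eq by (simp add: scale_left_diff_distrib algebra_simps)
      hence s: "scale (k - l) b \<in> span B"
        using yz by (simp add: span_diff)
      have "k = l"
      proof (rule ccontr)
        assume "k \<noteq> l"
        with span_scale[OF s, of "inverse (k - l)"] b show False by simp
      qed
      with eq show "k = l \<and> y = z" by simp
    qed
    moreover have "?f ` (UNIV \<times> span B) = span (insert b B)"
    proof (intro equalityI subsetI)
      fix x assume "x \<in> span (insert b B)"
      then obtain k where "x - scale k b \<in> span B"
        by (auto simp: span_insert)
      thus "x \<in> ?f ` (UNIV \<times> span B)"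
        by (intro image_eqI[of _ _ "(k, x - scale k b)"]) auto
    next
      fix x assume "x \<in> ?f ` (UNIV \<times> span B)"
      then obtain k y where "y \<in> span B" "x = scale k b + y" by auto
      hence "x - scale k b \<in> span B" by simp
      thus "x \<in> span (insert b B)" by (auto simp: span_insert)
    qed
    ultimately have "card (span (insert b B)) = card ((UNIV :: 'k set) \<times> span B)"
      by (metis card_image)
    thus ?case
      using insert B by (simp add: card_cartesian_product)
  qed simp
  obtain B where B: "B \<subseteq> V" "independent B" "V \<subseteq> span B" "card B = dim V"
    by (rule basis_exists)
  have "span B = V"
    using B(1,3) assms(2) by (rule span_subspace)
  moreover have "finite B"
    using B(1) assms(3) by (rule finite_subset)
  ultimately show ?thesis
    using card_span B by metis
qed

text \<open>Turns dimensions into counts: the rank and all weights below are found by counting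
  vectors.\<close>

lemma dim_eqI_card:
  fixes scale :: "'k::{field, finite} \<Rightarrow> 'v::ab_group_add \<Rightarrow> 'v"
  assumes "vector_space scale" "module.subspace scale V" "finite V" "card V = CARD('k) ^ d"
  shows "vector_space.dim scale V = d"
proof -
  have "card {0, 1 :: 'k} \<le> CARD('k)"
    by (rule card_mono) auto
  hence "1 < CARD('k)" by simp
  moreover have "CARD('k) ^ vector_space.dim scale V = CARD('k) ^ d"
    using card_subspace_eq_power_dim[OF assms(1-3)] assms(4) by simp
  ultimately show ?thesis
    by (simp add: power_inject_exp)
qed

text \<open>Subtracting \<open>y\<close> maps the fibre over \<open>f y\<close> injectively into the
  kernel.\<close>

lemma card_le_card_range_times_card_kernel:
  fixes f :: "'a::{ab_group_add, finite} \<Rightarrow> 'b::ab_group_add"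
  assumes "\<And>x y. f (x + y) = f x + f y"
  shows "CARD('a) \<le> card (range f) * card {x. f x = 0}"
proof -
  have diff: "f (x - y) = f x - f y" for x y
    using assms[of "x - y" y] by simp
  have fibre: "card (f -` {f y}) \<le> card {x. f x = 0}" for y
    by (rule card_inj_on_le[of "\<lambda>x. x - y"]) (auto simp: diff inj_on_def)
  have "CARD('a) = card (\<Union>z\<in>range f. f -` {z})"
    by (rule arg_cong[of _ _ card]) auto
  also have "\<dots> \<le> (\<Sum>z\<in>range f. card (f -` {z}))"
    by (rule card_UN_le) simp
  also have "\<dots> \<le> (\<Sum>z\<in>range f. card {x. f x = 0})"
    by (rule sum_mono) (use fibre in auto)
  finally show ?thesis by simp
qed

section \<open>Frobenius maps on finite fields\<close>

text \<open>Multiplication by a nonzero \<open>x\<close> permutes the nonzero elements, so their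
  product absorbs a factor \<open>x ^ card ?U\<close>.\<close>

lemma power_CARD_eq_self:
  fixes x :: "'a::{field, finite}"
  shows "x ^ CARD('a) = x"
proof (cases "x = 0")
  case False
  let ?U = "UNIV - {0 :: 'a}"
  have "bij_betw ((*) x) ?U ?U"
    by (rule bij_betw_byWitness[of _ "\<lambda>y. y / x"]) (use False in auto)
  hence "(\<Prod>y\<in>?U. x * y) = \<Prod>?U"
    by (rule prod.reindex_bij_betw)
  hence "x ^ card ?U = 1"
    by (simp add: prod.distrib)
  hence "x ^ Suc (card ?U) = x"
    by (simp only: power_Suc mult_1_right)
  thus ?thesis
    by (metis card_Suc_Diff1 finite_class.finite_UNIV UNIV_I)
qed (simp add: power_0_left)

lemma card_fixed_points_power_le:
  fixes k :: nat
  assumes "1 < k"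
  shows "card {x :: 'a::field. x ^ k = x} \<le> k"
proof -
  let ?p = "monom 1 k - monom 1 1 :: 'a poly"
  have "coeff ?p k = 1" using assms by simp
  hence "?p \<noteq> 0" by (metis coeff_0 zero_neq_one)
  hence "card {x. poly ?p x = 0} \<le> degree ?p"
    by (rule card_poly_roots_bound)
  also have "degree ?p \<le> k"
    using assms by (intro degree_diff_le) (auto intro: order.trans[OF degree_monom_le])
  finally show ?thesis
    by (simp add: poly_monom)
qed

lemma power_power_eq_self:
  fixes x :: "'a::monoid_mult"
  assumes "x ^ (q ^ m) = x"
  shows "x ^ (q ^ (m * j)) = x"
proof (induction j)
  case (Suc j)
  have "x ^ (q ^ (m * Suc j)) = (x ^ (q ^ m)) ^ (q ^ (m * j))"
    by (simp add: power_add flip: power_mult)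
  with Suc assms show ?case by simp
qed simp

text \<open>Bezout with natural coefficients avoids negative exponents. The case
  \<open>N = 0\<close> is included; coprimality then forces \<open>m = 1\<close>.\<close>

lemma power_eq_self_if_coprime:
  fixes x :: "'a::monoid_mult"
  assumes "x ^ (q ^ m) = x" "x ^ (q ^ N) = x" "coprime m N" "0 < m"
  shows "x ^ q = x"
proof -
  obtain a b where ab: "m * a = N * b + 1"
    using bezout_nat[of m N] assms(3,4) by (auto simp: coprime_iff_gcd_eq_1)
  have "x = x ^ (q ^ (N * b + 1))"
    using power_power_eq_self[OF assms(1), of a] ab by simp
  also have "\<dots> = (x ^ (q ^ (N * b))) ^ q"
    by (simp add: mult.commute flip: power_mult)
  finally show ?thesis
    using power_power_eq_self[OF assms(2), of b] by simp
qed

lemma power_q_power_add: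
  fixes x y :: "'a::{field, finite}"
  assumes "primepow q" "CARD('a) = q ^ h"
  shows "(x + y) ^ (q ^ k) = x ^ (q ^ k) + y ^ (q ^ k)"
proof -
  obtain p e where p: "prime p" "q = p ^ e"
    using assms(1) by (auto simp: primepow_def)
  have CHAR: "prime CHAR('a)"
    by (rule prime_CHAR_semidom) (simp add: finite_imp_CHAR_pos)
  \<comment> \<open>Translation by 1 permutes the field, so adding up the ones over all elements
    gives 0; hence the characteristic divides the field order, a power of \<open>p\<close>.\<close>
  have "(\<Sum>x\<in>UNIV. x + 1) = (\<Sum>x\<in>UNIV. x :: 'a)"
    by (rule sum.reindex_bij_betw) (rule bij_plus_right)
  hence "of_nat CARD('a) = (0 :: 'a)"
    by (simp add: sum.distrib)
  hence "CHAR('a) dvd p ^ (e * h)"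
    using assms(2) p(2) by (simp add: of_nat_eq_0_iff_char_dvd power_mult del: of_nat_power)
  hence "CHAR('a) = p"
    using CHAR p(1) by (meson prime_dvd_power primes_dvd_imp_eq)
  hence "q ^ k = CHAR('a) ^ (e * k)"
    using p(2) by (simp add: power_mult)
  thus ?thesis
    by (rule freshmans_dream'[OF CHAR])
qed

section \<open>Field embeddings and integer powers of the Frobenius map\<close>

lemma field_embedding_zero: "field_embedding f \<Longrightarrow> f 0 = 0"
  unfolding field_embedding_def by (metis add_cancel_right_right)

lemma field_embedding_eq_0_iff:
  assumes "field_embedding f"
  shows "f x = 0 \<longleftrightarrow> x = 0"
  using assms field_embedding_zero[OF assms]
  unfolding field_embedding_def by (metis mult_zero_left right_inverse zero_neq_one)

lemma inj_field_embedding: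
  assumes "field_embedding f"
  shows "inj f"
proof (rule injI)
  fix x y assume "f x = f y"
  moreover have "f (x - y) + f y = f x"
    using assms unfolding field_embedding_def by (metis diff_add_cancel)
  ultimately have "f (x - y) = 0" by simp
  thus "x = y"
    using field_embedding_eq_0_iff[OF assms] by simp
qed

lemma field_embedding_power:
  "field_embedding f \<Longrightarrow> f (x ^ k) = f x ^ k"
  by (induction k) (auto simp: field_embedding_def)

lemma field_embedding_q_power:
  assumes "primepow q" "CARD('a) = q ^ h"
  shows "field_embedding (\<lambda>x :: 'a::{field, finite}. x ^ (q ^ k))"
  using power_q_power_add[OF assms] by (simp add: field_embedding_def power_mult_distrib)

lemma bij_field_embedding_finite:
  "field_embedding (f :: 'a::{field, finite} \<Rightarrow> 'a) \<Longrightarrow> bij f"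
  by (simp add: bij_def finite_UNIV_inj_surj inj_field_embedding)

lemma field_embedding_inv:
  assumes "field_embedding f" "bij f"
  shows "field_embedding (inv f)"
proof -
  have inv: "inv f (f x) = x" "f (inv f y) = y" for x y
    using assms(2) by (auto simp: bij_def surj_f_inv_f)
  from assms(1) show ?thesis
    unfolding field_embedding_def by (metis inv)
qed

text \<open>A bijection and its inverse have the same fixed points, so the sign of \<open>n\<close>
  does not affect the fixed field.\<close>

lemma
  assumes "primepow q" "CARD('a::{field, finite}) = q ^ h"
  shows field_embedding_frob_power: "field_embedding (frob_power q n :: 'a \<Rightarrow> 'a)"
    and frob_power_eq_self_iff: "frob_power q n (x :: 'a) = x \<longleftrightarrow> x ^ (q ^ nat \<bar>n\<bar>) = x"
proof -
  let ?f = "\<lambda>x :: 'a. x ^ (q ^ nat (- n))"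
  have frob: "frob_power q n = (if n \<ge> 0 then \<lambda>x. x ^ (q ^ nat n) else inv ?f)"
    by (auto simp: frob_power_def fun_eq_iff)
  have f: "field_embedding ?f"
    by (rule field_embedding_q_power[OF assms])
  hence bij: "bij ?f"
    by (rule bij_field_embedding_finite)
  show "field_embedding (frob_power q n :: 'a \<Rightarrow> 'a)"
    using field_embedding_q_power[OF assms] field_embedding_inv[OF f bij] by (simp add: frob)
  have "inv ?f x = x \<longleftrightarrow> ?f x = x"
    using bij by (metis bij_inv_eq_iff)
  thus "frob_power q n x = x \<longleftrightarrow> x ^ (q ^ nat \<bar>n\<bar>) = x"
    by (auto simp: frob)
qed

text \<open>The image consists of roots of \<open>X^k - X\<close> with \<open>k = CARD('k)\<close>,
  and by injectivity it already has as many elements as there can be roots.\<close>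

lemma range_field_embedding_eq:
  fixes \<iota> :: "'k::{field, finite} \<Rightarrow> 'a::{field, finite}"
  assumes "field_embedding \<iota>"
  shows "range \<iota> = {x. x ^ CARD('k) = x}"
proof (rule card_seteq)
  show "range \<iota> \<subseteq> {x. x ^ CARD('k) = x}"
    by (auto simp: power_CARD_eq_self simp flip: field_embedding_power[OF assms])
  have "card {0, 1 :: 'k} \<le> CARD('k)"
    by (rule card_mono) auto
  thus "card {x :: 'a. x ^ CARD('k) = x} \<le> card (range \<iota>)"
    using card_fixed_points_power_le[of "CARD('k)"] inj_field_embedding[OF assms]
    by (simp add: card_image)
qed simp

section \<open>The relative trace\<close>

lemma rel_trace_add:
  fixes x y :: "'a::{field, finite}"
  assumes "primepow q" "CARD('a) = q ^ h"
  shows "rel_trace q h m (x + y) = rel_trace q h m x + rel_trace q h m y"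
  by (simp add: rel_trace_def power_q_power_add[OF assms] sum.distrib)

lemma rel_trace_mult:
  assumes "c ^ (q ^ m) = c"
  shows "rel_trace q h m (c * x) = c * rel_trace q h m x"
  by (simp add: rel_trace_def power_mult_distrib power_power_eq_self[OF assms] sum_distrib_left)

text \<open>Raising to the power \<open>q ^ m\<close> shifts the summands cyclically, because
  \<open>x ^ (q ^ h) = x\<close>.\<close>

lemma rel_trace_power_q_power:
  fixes x :: "'a::{field, finite}"
  assumes q: "primepow q" "CARD('a) = q ^ h" and m: "0 < m" "m dvd h" "0 < h"
  shows "rel_trace q h m x ^ (q ^ m) = rel_trace q h m x"
proof -
  define t where "t = h div m"
  have t: "h = m * t" "0 < t"
    using m by (auto simp: t_def)
  have L: "rel_trace q h m x = (\<Sum>j<t. x ^ (q ^ (m * j)))"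
    using t(2) by (simp add: rel_trace_def flip: t_def)
      (intro sum.cong, auto)
  have "rel_trace q h m x ^ (q ^ m) = (\<Sum>j<t. (x ^ (q ^ (m * j))) ^ (q ^ m))"
  proof -
    have "(\<Sum>j\<in>A. g j) ^ (q ^ m) = (\<Sum>j\<in>A. g j ^ (q ^ m))" if "finite A"
      for A and g :: "nat \<Rightarrow> 'a"
      using that field_embedding_zero[OF field_embedding_q_power[OF q, of m]]
      by (induction rule: finite_induct) (auto simp: power_q_power_add[OF q])
    thus ?thesis by (simp add: L)
  qed
  also have "\<dots> = (\<Sum>j<t. x ^ (q ^ (m * Suc j)))"
    by (simp add: power_add mult.commute flip: power_mult)
  also have "\<dots> = (\<Sum>j<Suc t. x ^ (q ^ (m * j))) - x"
    by (subst sum.lessThan_Suc_shift) simp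
  \<comment> \<open>The top summand, with exponent \<open>q ^ (m * t) = q ^ h\<close>, equals
    \<open>x\<close> and cancels the subtracted term.\<close>
  also have "\<dots> = (\<Sum>j<t. x ^ (q ^ (m * j)))"
    using power_CARD_eq_self[of x] q(2) t(1) by simp
  finally show ?thesis by (simp add: L)
qed

lemma card_rel_trace_kernel_le:
  assumes "1 < q" "0 < m" "m dvd h" "0 < h"
  shows "card {x :: 'a::field. rel_trace q h m x = 0} \<le> q ^ (h - m)"
proof -
  let ?p = "\<Sum>j = 0..h div m - 1. monom 1 (q ^ (m * j)) :: 'a poly"
  \<comment> \<open>Since \<open>1 < q\<close> and \<open>0 < m\<close>, the exponent
    \<open>q ^ (m * j)\<close> is 1 only for \<open>j = 0\<close>; the linear coefficient thus shows
    that \<open>?p\<close> is nonzero.\<close>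
  have "coeff ?p 1 = (\<Sum>j = 0..h div m - 1. if j = 0 then 1 else 0)"
    unfolding coeff_sum by (rule sum.cong) (use assms in auto)
  hence "coeff ?p 1 = 1" by simp
  hence "?p \<noteq> 0" by (metis coeff_0 zero_neq_one)
  hence "card {x. poly ?p x = 0} \<le> degree ?p"
    by (rule card_poly_roots_bound)
  also have "degree ?p \<le> q ^ (h - m)"
  proof (rule degree_sum_le)
    fix j assume "j \<in> {0..h div m - 1}"
    hence "m * j \<le> m * (h div m - 1)"
      by (intro mult_le_mono) auto
    also have "\<dots> = h - m"
      using assms(3) by (simp add: right_diff_distrib')
    finally show "degree (monom (1 :: 'a) (q ^ (m * j))) \<le> q ^ (h - m)"
      using assms(1) by (simp add: degree_monom_eq power_increasing)
  qed simp
  finally show ?thesis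
    by (simp add: rel_trace_def poly_sum poly_monom)
qed

lemma card_rel_trace_kernel:
  assumes q: "primepow q" "CARD('a::{field, finite}) = q ^ h" and m: "0 < m" "m dvd h" "0 < h"
  shows "card {x :: 'a. rel_trace q h m x = 0} = q ^ (h - m)"
proof (rule antisym)
  have q1: "1 < q"
    using primepow_gt_Suc_0[OF q(1)] by simp
  show "card {x :: 'a. rel_trace q h m x = 0} \<le> q ^ (h - m)"
    by (rule card_rel_trace_kernel_le[OF q1 m])
  have "card (range (rel_trace q h m :: 'a \<Rightarrow> 'a)) \<le> card {x :: 'a. x ^ (q ^ m) = x}"
    by (rule card_mono) (auto simp: rel_trace_power_q_power[OF q m])
  also have "\<dots> \<le> q ^ m"
    by (rule card_fixed_points_power_le[OF one_less_power[OF q1 m(1)]])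
  finally have "q ^ h \<le> q ^ m * card {x :: 'a. rel_trace q h m x = 0}"
    using card_le_card_range_times_card_kernel[of "rel_trace q h m :: 'a \<Rightarrow> 'a"] rel_trace_add[OF q]
    by (metis (no_types, lifting) q(2) mult_le_mono1 order.trans)
  moreover have "q ^ h = q ^ m * q ^ (h - m)"
    using m by (simp add: dvd_imp_le flip: power_add)
  ultimately show "q ^ (h - m) \<le> card {x :: 'a. rel_trace q h m x = 0}"
    using q1 by simp
qed

section \<open>The club\<close>

lemma proj_point_eq: "proj_point v = range (\<lambda>c. (c * fst v, c * snd v))"
proof -
  interpret vector_space "scale2 id"
    by (rule vector_space_scale2[OF field_embedding_id])
  show ?thesis
    by (simp add: proj_point_def span_singleton scale2_def)
qed

lemma subspace_inter_proj_point:
  assumes "field_embedding \<iota>" "module.subspace (scale2 \<iota>) W"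
  shows "module.subspace (scale2 \<iota>) (W \<inter> proj_point v)"
proof -
  interpret vector_space "scale2 \<iota>"
    by (rule vector_space_scale2[OF assms(1)])
  have "subspace (proj_point v)"
    unfolding subspace_def proj_point_eq
    by (auto simp: image_iff scale2_def zero_prod_def
        simp flip: distrib_right mult.assoc intro: exI[of _ 0])
  thus ?thesis
    using assms(2) by (simp add: subspace_inter)
qed

text \<open>A multiple \<open>(c * f x, c * x)\<close> lies on the graph iff its first entry is
  \<open>f (c * x)\<close>, and \<open>x \<noteq> 0\<close> makes \<open>c\<close> recoverable from
  the second entry.\<close>

lemma card_graph_inter_proj_point:
  fixes f :: "'a::{field, finite} \<Rightarrow> 'a"
  assumes "x \<noteq> 0"
  shows "card (range (\<lambda>y. (f y, y)) \<inter> proj_point (f x, x)) = card {c. f (c * x) = c * f x}"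
proof -
  have "range (\<lambda>y. (f y, y)) \<inter> proj_point (f x, x) =
      (\<lambda>c. (c * f x, c * x)) ` {c. f (c * x) = c * f x}"
    by (force simp: proj_point_eq)
  thus ?thesis
    using assms by (simp add: card_image inj_on_def)
qed

theorem theorem3p3:
  fixes \<iota> :: "'k::{field, finite} \<Rightarrow> 'a::{field, finite}"
    and q h i :: nat and n :: int
  assumes "primepow q"
    and "CARD('k) = q" and "CARD('a) = q ^ h"
    and "field_embedding \<iota>"
    and "1 \<le> i" and "i < h" and "(h - i) dvd h"
    and "gcd (int (h - i)) n = 1"
  shows "is_club \<iota> i h
           {proj_point (frob_power q n (rel_trace q h (h - i) x), x) | x :: 'a. x \<noteq> 0}"
proof -
  note q = assms(1,3)
  define m where "m = h - i"
  have m: "0 < m" "m dvd h" "0 < h" and i: "h - m = i"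
    using assms(5-7) by (auto simp: m_def)
  define L :: "'a \<Rightarrow> 'a" where "L = rel_trace q h m"
  define \<phi> :: "'a \<Rightarrow> 'a" where "\<phi> = frob_power q n"
  define f where "f = (\<lambda>x. \<phi> (L x))"
  define W where "W = range (\<lambda>x. (f x, x))"
  define C where "C = {proj_point (f x, x) | x. x \<noteq> 0}"
  have \<phi>: "field_embedding \<phi>"
    unfolding \<phi>_def by (rule field_embedding_frob_power[OF q])
  have \<phi>_mult: "\<phi> (x * y) = \<phi> x * \<phi> y" and \<phi>_add: "\<phi> (x + y) = \<phi> x + \<phi> y" for x y
    using \<phi> by (auto simp: field_embedding_def)
  have \<phi>_0: "\<phi> x = 0 \<longleftrightarrow> x = 0" for x
    by (rule field_embedding_eq_0_iff[OF \<phi>])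
  have f_eq_0: "f x = 0 \<longleftrightarrow> L x = 0" for x
    by (simp add: f_def \<phi>_0)
  have L_mult: "L (c * x) = c * L x" if "c ^ (q ^ m) = c" for c x
    unfolding L_def using that by (rule rel_trace_mult)
  have L_fixed: "L x ^ (q ^ m) = L x" for x
    unfolding L_def by (rule rel_trace_power_q_power[OF q m])
  have range_\<iota>: "c \<in> range \<iota> \<longleftrightarrow> c ^ q = c" for c
    using range_field_embedding_eq[OF assms(4)] assms(2) by simp
  have f_add: "f (x + y) = f x + f y" for x y
    by (simp add: f_def L_def rel_trace_add[OF q] \<phi>_add)
  have f_0: "f 0 = 0"
    using f_add[of 0 0] by (metis add_cancel_right_right)
  \<comment> \<open>Although \<phi> is only semilinear, it fixes such a \<open>c\<close>, and
    \<open>L\<close> is linear over the larger field fixed by the power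
    \<open>q ^ m\<close>.\<close>
  have f_mult: "f (c * x) = c * f x" if "c ^ q = c" for c x
  proof -
    have pow: "c ^ (q ^ k) = c" for k
      using power_power_eq_self[of c q 1 k] that by simp
    hence "\<phi> c = c"
      unfolding \<phi>_def by (simp add: frob_power_eq_self_iff[OF q])
    thus ?thesis
      by (simp add: f_def L_mult pow \<phi>_mult)
  qed

  interpret vector_space "scale2 \<iota>"
    by (rule vector_space_scale2[OF assms(4)])
  have f_\<iota>: "f (\<iota> c * x) = \<iota> c * f x" for c x
    by (rule f_mult) (simp flip: range_\<iota>)
  have W: "subspace W"
    unfolding subspace_def W_def
    by (auto simp: scale2_def zero_prod_def f_0 intro: range_eqI[of _ _ 0] simp flip: f_add f_\<iota>)
  have "card W = q ^ h"
    using assms(3) by (simp add: W_def card_image inj_on_def)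
  hence dim_W: "dim W = h"
    using assms(2) by (intro dim_eqI_card[OF vector_space_axioms W]) auto
  have C: "C = points_of W"
  proof -
    have "W - {0} = (\<lambda>x. (f x, x)) ` {x. x \<noteq> 0}"
      by (auto simp: W_def zero_prod_def f_0)
    thus ?thesis
      unfolding C_def points_of_def setcompr_eq_image by (simp only: Collect_mem_eq image_image)
  qed

  have weightI: "weight \<iota> W (proj_point (f x, x)) = d"
    if "x \<noteq> 0" "card {c. f (c * x) = c * f x} = q ^ d" for x d
    unfolding weight_def
    using that assms(2) subspace_inter_proj_point[OF assms(4) W]
    by (intro dim_eqI_card[OF vector_space_axioms])
      (auto simp: W_def card_graph_inter_proj_point)

  have ker: "card {x. L x = 0} = q ^ i"
    unfolding L_def using card_rel_trace_kernel[OF q m] by (simp add: i)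
  have weight_head: "weight \<iota> W (proj_point (f x, x)) = i" if x: "x \<noteq> 0" "L x = 0" for x
  proof (rule weightI[OF x(1)])
    have "f x = 0"
      using x(2) by (simp add: f_eq_0)
    hence "{c. f (c * x) = c * f x} = {c. L (c * x) = 0}"
      by (simp flip: f_eq_0)
    \<comment> \<open>Scaling by \<open>x\<close> identifies the admissible scalars with the kernel
      of \<open>L\<close>.\<close>
    moreover have "bij_betw (\<lambda>c. c * x) {c. L (c * x) = 0} {y. L y = 0}"
      by (rule bij_betw_byWitness[of _ "\<lambda>y. y / x"]) (use x in auto)
    ultimately show "card {c. f (c * x) = c * f x} = q ^ i"
      using ker by (simp add: bij_betw_same_card)
  qed
  have weight_other: "weight \<iota> W (proj_point (f x, x)) = 1" if x: "x \<noteq> 0" "L x \<noteq> 0" for x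
  proof (rule weightI[OF x(1)])
    have "c ^ q = c" if c: "f (c * x) = c * f x" for c
    proof (rule power_eq_self_if_coprime)
      have "c * \<phi> (L x) = \<phi> (L (c * x) / L x) * \<phi> (L x)"
        using c x(2) by (simp add: f_def flip: \<phi>_mult)
      hence "c = \<phi> (L (c * x) / L x)"
        using x(2) by (simp add: \<phi>_0)
      \<comment> \<open>A quotient of traces is fixed by the power \<open>q ^ m\<close>, and \<phi>
        commutes with powers.\<close>
      thus cm: "c ^ (q ^ m) = c"
        by (metis L_fixed field_embedding_power[OF \<phi>] power_divide)
      \<comment> \<open>Now \<open>c\<close> can be pulled out of \<open>L\<close>, and the nonzero
        factor \<open>\<phi> (L x)\<close> cancels.\<close>
      have "\<phi> c = c"
        using c x(2) by (simp add: f_def L_mult[OF cm] \<phi>_mult \<phi>_0)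
      thus "c ^ (q ^ nat \<bar>n\<bar>) = c"
        unfolding \<phi>_def by (simp add: frob_power_eq_self_iff[OF q])
      have "coprime (int m) \<bar>n\<bar>"
        using assms(8) by (simp add: m_def coprime_iff_gcd_eq_1)
      thus "coprime m (nat \<bar>n\<bar>)"
        by (metis coprime_int_iff abs_ge_zero int_nat_eq)
    qed (rule m)
    hence "{c. f (c * x) = c * f x} = range \<iota>"
      using f_mult range_\<iota> by blast
    thus "card {c. f (c * x) = c * f x} = q ^ 1"
      using assms(2) inj_field_embedding[OF assms(4)] by (simp add: card_image)
  qed

  \<comment> \<open>\<open>1 \<le> i\<close> gives the kernel of \<open>L\<close> a nonzero element,
    so the head exists.\<close>
  have "1 < q ^ i"
    using primepow_gt_Suc_0[OF assms(1)] assms(5) by (intro one_less_power) auto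
  hence "{x. L x = 0} \<noteq> {0}"
    using ker by auto
  moreover have "L 0 = 0"
    using f_0 by (simp add: f_eq_0)
  ultimately obtain a where a: "a \<noteq> 0" "L a = 0"
    by auto
  \<comment> \<open>All nonzero kernel elements yield the point of vectors with first entry 0. Hence
    any other point of \<open>C\<close> comes from some \<open>x\<close> with
    \<open>L x \<noteq> 0\<close> and has weight 1.\<close>
  have same_head: "proj_point (f x, x) = proj_point (f a, a)" if x: "x \<noteq> 0" "L x = 0" for x
  proof -
    have "f x = 0" "f a = 0"
      using x a by (auto simp: f_eq_0)
    moreover have "range (\<lambda>c. c * y) = UNIV" if "y \<noteq> 0" for y :: 'a
      using that by (auto intro!: range_eqI[of _ _ "_ / y"])
    hence "range (\<lambda>c. (0 :: 'a, c * y)) = Pair 0 ` UNIV" if "y \<noteq> 0" for y :: 'a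
      using that by (metis image_image)
    ultimately show ?thesis
      using x(1) a(1) by (simp add: proj_point_eq)
  qed
  have "proj_point (f a, a) \<in> C"
    using a by (auto simp: C_def)
  moreover have "weight \<iota> W Q = 1" if "Q \<in> C - {proj_point (f a, a)}" for Q
    using that same_head weight_other by (auto simp: C_def)
  ultimately have "is_club \<iota> i h C"
    unfolding is_club_def linear_set_of_rank_def
    using W dim_W C weight_head[OF a] by blast
  thus ?thesis
    by (simp add: C_def f_def \<phi>_def L_def m_def)
qed

end
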